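(* Let $n\ge 0$, let $\pi\in\mathfrak S_{n+1}$ and let $\mathcal T=T'(\pi)$. Then $$(\mathcal X(\mathcal T),c_0(\mathcal T),c_1(\mathcal T),\mathrm{yy}(\mathcal T))=(\mathcal X(\pi),c(\pi),c'(\pi),\mathrm{yy}(\pi)),$$ where $\mathcal X(\pi)$ is regarded as an element of $\{0,1\}^n$.
   Context: Marked cycles and the tree $T(\sigma,s)$: Let $S$ be a finite nonempty totally ordered set. A marked cycle on $S$ is a pair $(\sigma,s)$ with $\sigma$ a cyclic permutation of $S$ and $s\in\{\min S,\max S\}$. Write $W=a_1\cdots a_m$ with $m=|S|-1$ and $a_j=\sigma^j(s)$. If $s=\min S$ let $x_k>\cdots>x_1$ be the right-to-left maxima of $W$ (letters larger than all letters to their right); if $s=\max S$ let $x_k<\cdots<x_1$ be the right-to-left minima of $W$ (letters smaller than all letters to their right). Then $W=W_kx_k\cdots W_1x_1$ for uniquely determined (possibly empty) words $W_i$. Define $T(\sigma,s)$ recursively: if $S=\{s\}$ it is the single vertex $s$; otherwise it has root $s$, the children of $s$ are $x_1,\ldots,x_k$, and the subtree rooted at $x_i$ is $T(\sigma_i,x_i)$ where $\sigma_i$ is the cyclic permutation of the letters of $W_ix_i$ sending each letter to the next one and $x_i$ to the first letter of $W_ix_i$. The map $T'$: for $\pi\in\mathfrak S_{n+1}$ (a permutation of $\{1,\ldots,n+1\}$) with cycles $\sigma_1,\ldots,\sigma_k$ and $s_i=$ maximal element of $\sigma_i$, $T'(\pi)$ is the rooted tree on $\{0,1,\ldots,n+1\}$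 with root $0$, whose children of $0$ are $s_1,\ldots,s_k$, and whose subtree rooted at $s_i$ is $T(\sigma_i,s_i)$ (with $\sigma_i$ regarded as a cyclic permutation of its support). Tree statistics: for a rooted tree $\mathcal T$ on $\{0,\ldots,n+1\}$ with root $0$, let $p(i)$ be the parent of a non-root vertex $i$. A non-root vertex $i$ is an excedance if $i<p(i)$. $\mathcal X(\mathcal T)\in\{0,1\}^n$ has $\mathcal X(\mathcal T)(i)=1$ iff $i\in\{1,\ldots,n\}$ is an excedance. $\mathrm{yy}(\mathcal T)$ is the number of pairs $1\le i<j\le n$ with $p(j)<i<j<p(i)$. $c_0(\mathcal T)$ is the number of children of $0$ and $c_1(\mathcal T)$ the number of children of $n+1$. Permutation statistics for $\pi\in\mathfrak S_{n+1}$: $\mathcal X(\pi)=\{i\in[n]:\pi(i)>i\}$; $c(\pi)$ is the number of cycles of $\pi$; if the cycle of $\pi$ containing $n+1$ has length $m$, let $W=\pi(n+1)\pi^2(n+1)\cdots\pi^{m-1}(n+1)$ (empty if $m=1$) and let $c'(\pi)$ be the number of right-to-left minima of $W$ (letters smaller than all letters to their right in $W$); $\mathrm{yy}(\pi):=\mathrm{yy}(T'(\pi))$. *)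

theory Defs
  imports "HOL-Library.FSet" "HOL-Combinatorics.Combinatorics"
begin

text \<open>Right-to-left extrema of a word: \<open>R = (<)\<close> gives the right-to-left maxima and
  \<open>R = (>)\<close> the right-to-left minima. Both functions work from left to right, so the
  rightmost extremum, which is $x_1$, is the last entry.\<close>

fun rl_extrema :: "('a \<Rightarrow> 'a \<Rightarrow> bool) \<Rightarrow> 'a list \<Rightarrow> 'a list" where
  "rl_extrema R [] = []"
| "rl_extrema R (a # w) =
     (if \<forall>b\<in>set w. R b a then a # rl_extrema R w else rl_extrema R w)"

text \<open>The factorization $W = W_k x_k \cdots W_1 x_1$, as the list of the factors $W_i x_i$:
  a factor ends exactly at an extremum (see \<open>concat_rl_blocks\<close> and the two lemmas after
  it). The last letter of a nonempty word is an extremum, so the branch for \<open>[]\<close> in the case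
  distinction is never reached.\<close>

fun rl_blocks :: "('a \<Rightarrow> 'a \<Rightarrow> bool) \<Rightarrow> 'a list \<Rightarrow> 'a list list" where
  "rl_blocks R [] = []"
| "rl_blocks R (a # w) =
     (if \<forall>b\<in>set w. R b a then [a] # rl_blocks R w
      else (case rl_blocks R w of [] \<Rightarrow> [[a]] | b # bs \<Rightarrow> (a # b) # bs))"

lemma concat_rl_blocks: "concat (rl_blocks R w) = w"
  by (induction w) (auto split: list.splits)

lemma Nil_notin_rl_blocks: "[] \<notin> set (rl_blocks R w)"
  by (induction w) (auto split: list.splits)

lemma map_last_rl_blocks: "map last (rl_blocks R w) = rl_extrema R w"
proof (induction w)
  case (Cons a w)
  show ?case
  proof (cases "\<forall>b\<in>set w. R b a")
    case False
    then have "w \<noteq> []" by auto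
    then obtain b bs where b: "rl_blocks R w = b # bs"
      using concat_rl_blocks[of R w] by (cases "rl_blocks R w") auto
    then have "b \<noteq> []" using Nil_notin_rl_blocks[of R w] by auto
    then show ?thesis using False Cons b by auto
  qed (use Cons in auto)
qed simp

lemma length_le_of_rl_blocks:
  assumes "b \<in> set (rl_blocks R w)"
  shows "length b \<le> length w"
proof -
  have "length b \<le> sum_list (map length (rl_blocks R w))"
    using assms by (intro member_le_sum_list) auto
  also have "\<dots> = length (concat (rl_blocks R w))"
    by (simp add: length_concat)
  finally show ?thesis by (simp add: concat_rl_blocks)
qed

text \<open>The cyclic permutation \<open>\<sigma>\<close> of \<open>S\<close> is a function on the whole type that fixes everything
  outside \<open>S\<close>.\<close>

definition marked_cycle :: "'a::linorder set \<Rightarrow> ('a \<Rightarrow> 'a) \<Rightarrow> 'a \<Rightarrow> bool" where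
  "marked_cycle S \<sigma> s \<longleftrightarrow> finite S \<and> S \<noteq> {} \<and> \<sigma> permutes S \<and> cyclic_on \<sigma> S \<and> s \<in> {Min S, Max S}"

definition cycle_word :: "'a set \<Rightarrow> ('a \<Rightarrow> 'a) \<Rightarrow> 'a \<Rightarrow> 'a list" where
  "cycle_word S \<sigma> s = map (\<lambda>j. (\<sigma> ^^ j) s) [1..<card S]"

definition cycle_blocks :: "'a::linorder set \<Rightarrow> ('a \<Rightarrow> 'a) \<Rightarrow> 'a \<Rightarrow> 'a list list" where
  "cycle_blocks S \<sigma> s = rl_blocks (if s = Min S then (<) else (>)) (cycle_word S \<sigma> s)"

text \<open>Rooted trees without an order on the children of a vertex.\<close>

datatype 'a rtree = Node (root: 'a) (subtrees: "'a rtree fset")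

primrec verts :: "'a rtree \<Rightarrow> 'a set" where
  "verts (Node v ts) = insert v (\<Union> (fset (verts |`| ts)))"

text \<open>Edges are pairs of a parent and one of its children.\<close>

primrec edges :: "'a rtree \<Rightarrow> ('a \<times> 'a) set" where
  "edges (Node v ts) = (\<lambda>t. (v, root t)) ` fset ts \<union> \<Union> (fset (edges |`| ts))"

definition parent :: "'a rtree \<Rightarrow> 'a \<Rightarrow> 'a" where
  "parent t i = (THE j. (j, i) \<in> edges t)"

definition children :: "'a rtree \<Rightarrow> 'a \<Rightarrow> 'a set" where
  "children t i = {j. (i, j) \<in> edges t}"

lemma fimage_fundef_cong [fundef_cong]:
  "A = B \<Longrightarrow> (\<And>x. x |\<in>| B \<Longrightarrow> f x = g x) \<Longrightarrow> f |`| A = g |`| B"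
  by (rule fset.map_cong)

text \<open>The tree $T(\sigma,s)$ of a marked cycle on \<open>S\<close>. A factor \<open>b\<close> $= W_i x_i$ has letter set
  \<open>set b\<close> and last letter $x_i$, and $\sigma_i$ is \<open>cycle_of_list b\<close>.\<close>

function cycle_tree :: "'a::linorder set \<Rightarrow> ('a \<Rightarrow> 'a) \<Rightarrow> 'a \<Rightarrow> 'a rtree" where
  "cycle_tree S \<sigma> s =
     (if S = {s} then Node s {||}
      else Node s ((\<lambda>b. cycle_tree (set b) (cycle_of_list b) (last b))
                     |`| fset_of_list (cycle_blocks S \<sigma> s)))"
  by pat_completeness auto
termination
proof (relation "measure (\<lambda>(S, _, _). card S)", goal_cases)
  case (2 S \<sigma> s b)
  then have b: "b \<in> set (cycle_blocks S \<sigma> s)"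
    by (simp add: fset_of_list_elem)
  then have "length b \<le> length (cycle_word S \<sigma> s)"
    unfolding cycle_blocks_def by (rule length_le_of_rl_blocks)
  moreover have "b \<noteq> []"
    using b Nil_notin_rl_blocks unfolding cycle_blocks_def by blast
  ultimately have "length b < card S"
    by (cases b) (auto simp: cycle_word_def)
  then show ?case
    using card_length[of b] by simp
qed simp

declare cycle_tree.simps [simp del]

text \<open>Permutations of \<open>{1..n+1}\<close>. A cycle is given by its set of letters.\<close>

definition perm_cycles :: "nat \<Rightarrow> (nat \<Rightarrow> nat) \<Rightarrow> nat set set" where
  "perm_cycles n \<pi> = orbit \<pi> ` {1..n+1}"

definition perm_tree :: "nat \<Rightarrow> (nat \<Rightarrow> nat) \<Rightarrow> nat rtree" where
  "perm_tree n \<pi> =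
     Node 0 ((\<lambda>C. cycle_tree C (perm_restrict \<pi> C) (Max C)) |`| Abs_fset (perm_cycles n \<pi>))"

text \<open>The lemmas below show that the recursion stays within marked cycles and that \<open>perm_tree\<close> is
  a rooted tree on \<open>{0..n+1}\<close>.\<close>

lemma rl_blocks_last:
  fixes R :: "'a \<Rightarrow> 'a \<Rightarrow> bool"
  assumes tr: "transp R" and tot: "totalp R" and d: "distinct w" and b: "b \<in> set (rl_blocks R w)"
  shows "\<forall>a\<in>set b. a = last b \<or> R a (last b)"
proof -
  have "(\<forall>b\<in>set (rl_blocks R w). \<forall>a\<in>set b. a = last b \<or> R a (last b)) \<and>
        (w \<noteq> [] \<longrightarrow> (\<forall>a\<in>set w. a = last (hd (rl_blocks R w)) \<or> R a (last (hd (rl_blocks R w)))))"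
    using d
  proof (induction w)
    case (Cons a w)
    show ?case
    proof (cases "\<forall>b\<in>set w. R b a")
      case False
      then obtain c where c: "c \<in> set w" "\<not> R c a" by blast
      have "w \<noteq> []" using c by auto
      then obtain b bs where bb: "rl_blocks R w = b # bs"
        using concat_rl_blocks[of R w] by (cases "rl_blocks R w") auto
      have bne: "b \<noteq> []" using Nil_notin_rl_blocks[of R w] bb by auto
      have IH: "\<forall>b\<in>set (rl_blocks R w). \<forall>a\<in>set b. a = last b \<or> R a (last b)"
        "\<forall>a\<in>set w. a = last b \<or> R a (last b)"
        using Cons bb \<open>w \<noteq> []\<close> by auto
      have "a \<noteq> c" using c Cons.prems by auto
      then have "R a c" using c(2) tot unfolding totalp_on_def by blast
      then have "R a (last b)" using IH(2) c(1) tr by (metis transpD)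
      then show ?thesis using False IH bb bne by auto
    qed (use Cons in auto)
  qed simp
  then show ?thesis using b by blast
qed

lemma set_rl_blocks_subset: "b \<in> set (rl_blocks R w) \<Longrightarrow> set b \<subseteq> set w"
  using concat_rl_blocks[of R w] by (metis Union_upper image_eqI set_concat)

lemma distinct_rl_blocks: "distinct w \<Longrightarrow> b \<in> set (rl_blocks R w) \<Longrightarrow> distinct b"
  using concat_rl_blocks[of R w] by (metis distinct_concat_iff)

lemma cycle_word_props:
  assumes "cyclic_on \<sigma> S" "s \<in> S"
  shows "distinct (s # cycle_word S \<sigma> s)" "set (s # cycle_word S \<sigma> s) = S"
proof -
  have S: "S = orbit \<sigma> s" and so: "s \<in> orbit \<sigma> s"
    using assms by (auto simp: cyclic_on_alldef)
  let ?k = "funpow_dist1 \<sigma> s s"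
  have im: "S = (\<lambda>n. (\<sigma> ^^ n) s) ` {0..<?k}"
    using orbit_conv_funpow_dist1[OF so] S by simp
  have inj: "inj_on (\<lambda>n. (\<sigma> ^^ n) s) {0..<?k}"
    using so by (rule inj_on_funpow_dist1)
  have c: "card S = ?k" using card_image[OF inj] im by simp
  have eq: "s # cycle_word S \<sigma> s = map (\<lambda>n. (\<sigma> ^^ n) s) [0..<card S]"
    unfolding cycle_word_def using c by (simp del: upt_Suc funpow.simps add: upt_conv_Cons)
  show "distinct (s # cycle_word S \<sigma> s)"
    unfolding eq using inj c by (simp only: distinct_map distinct_upt set_upt)
  show "set (s # cycle_word S \<sigma> s) = S"
    unfolding eq using im c by (simp only: set_map set_upt)
qed

lemma cyclic_on_cycle_of_list:
  assumes "distinct b" "b \<noteq> []"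
  shows "cyclic_on (cycle_of_list b) (set b)"
proof -
  let ?f = "cycle_of_list b"
  have f: "(?f ^^ n) (b ! 0) = b ! (n mod length b)" for n
  proof -
    have "map (?f ^^ n) b ! 0 = rotate n b ! 0" using cyclic_rotation[OF assms(1)] by simp
    then show ?thesis using assms(2) by (simp add: nth_rotate)
  qed
  have "permutation ?f" by (rule permutation_of_cycle)
  then have c: "cyclic_on ?f (orbit ?f (b ! 0))" by (rule cyclic_on_orbit')
  have "orbit ?f (b ! 0) = set b"
  proof
    show "orbit ?f (b ! 0) \<subseteq> set b"
      using assms(2) by (auto simp: orbit_altdef f)
    show "set b \<subseteq> orbit ?f (b ! 0)"
    proof
      fix x assume "x \<in> set b"
      then obtain i where i: "i < length b" "x = b ! i" by (auto simp: in_set_conv_nth)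
      then have "x = (?f ^^ (i + length b)) (b ! 0)" by (simp add: f)
      moreover have "0 < i + length b" using i by linarith
      ultimately show "x \<in> orbit ?f (b ! 0)" unfolding orbit_altdef by blast
    qed
  qed
  then show ?thesis using c by simp
qed

lemma marked_cycle_cycle_blocks:
  assumes "marked_cycle S \<sigma> s" "b \<in> set (cycle_blocks S \<sigma> s)"
  shows "marked_cycle (set b) (cycle_of_list b) (last b)"
proof -
  have "s \<in> S" using assms(1) Min_in Max_in unfolding marked_cycle_def by blast
  then have "distinct (cycle_word S \<sigma> s)"
    using cycle_word_props[of \<sigma> S s] assms(1) unfolding marked_cycle_def by auto
  note d = this
  have bne: "b \<noteq> []" using assms(2) Nil_notin_rl_blocks unfolding cycle_blocks_def by blast
  have db: "distinct b" using d assms(2) distinct_rl_blocks unfolding cycle_blocks_def by blast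
  have "last b \<in> {Min (set b), Max (set b)}"
  proof (cases "s = Min S")
    case True
    have "\<forall>a\<in>set b. a = last b \<or> a < last b"
      using assms(2) True unfolding cycle_blocks_def
      by (intro rl_blocks_last[OF _ _ d]) (auto simp: transp_def totalp_on_def)
    then have "Max (set b) = last b" using bne by (intro Max_eqI) auto
    then show ?thesis by simp
  next
    case False
    have "\<forall>a\<in>set b. a = last b \<or> a > last b"
      using assms(2) False unfolding cycle_blocks_def
      by (intro rl_blocks_last[OF _ _ d]) (auto simp: transp_def totalp_on_def)
    then have "Min (set b) = last b" using bne by (intro Min_eqI) auto
    then show ?thesis by simp
  qed
  then show ?thesis
    using bne db cyclic_on_cycle_of_list[OF db bne] cycle_permutes[of b]
    unfolding marked_cycle_def by auto
qed

lemma perm_cycles_props: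
  assumes "\<pi> permutes {1..n+1}" "C \<in> perm_cycles n \<pi>"
  shows "marked_cycle C (perm_restrict \<pi> C) (Max C)" "C \<subseteq> {1..n+1}"
proof -
  obtain i where i: "i \<in> {1..n+1}" "C = orbit \<pi> i" using assms(2) by (auto simp: perm_cycles_def)
  have c: "cyclic_on \<pi> C" using cyclic_on_orbit[OF assms(1)] i by simp
  show CS: "C \<subseteq> {1..n+1}"
    using permutes_orbit_subset[OF assms(1) i(1)] i by simp
  have "cyclic_on (perm_restrict \<pi> C) C"
    using c by (subst cyclic_cong[where g = \<pi>]) (auto simp: perm_restrict_simps)
  moreover have "perm_restrict \<pi> C permutes C"
    unfolding permutes_def
  proof (intro conjI allI impI)
    show "x \<notin> C \<Longrightarrow> perm_restrict \<pi> C x = x" for x by (rule perm_restrict_simps)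
    fix y
    have inj: "inj \<pi>" using assms(1) by (rule permutes_inj)
    have mem: "\<pi> x \<in> C \<longleftrightarrow> x \<in> C" for x
      using cyclic_on_inI[OF c] cyclic_on_f_in[OF assms(1) c] by blast
    show "\<exists>!x. perm_restrict \<pi> C x = y"
    proof (cases "y \<in> C")
      case True
      obtain x where x: "\<pi> x = y" using permutes_surj[OF assms(1)] by (metis surjD)
      show ?thesis
        by (rule ex1I[of _ x]) (use x True mem inj in \<open>auto simp: perm_restrict_def inj_def split: if_splits\<close>)
    next
      case False
      show ?thesis
        by (rule ex1I[of _ y]) (use False mem in \<open>auto simp: perm_restrict_def split: if_splits\<close>)
    qed
  qed
  moreover have "C \<noteq> {}" "finite C" using c finite_subset[OF CS] by (auto simp: cyclic_on_def)
  ultimately show "marked_cycle C (perm_restrict \<pi> C) (Max C)" by (auto simp: marked_cycle_def)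
qed


lemma distinct_concat_disjoint:
  assumes "distinct (concat bs)" "b \<in> set bs" "b' \<in> set bs" "b \<noteq> b'" "b \<noteq> []"
  shows "set b \<inter> set b' = {}"
  using assms by (auto simp: distinct_concat_iff)

lemma edges_Node: "(j, i) \<in> edges (Node v ts) \<longleftrightarrow>
    (\<exists>t. t |\<in>| ts \<and> (j = v \<and> i = root t \<or> (j, i) \<in> edges t))"
  by (auto simp: fimage.rep_eq)

lemma verts_Node: "verts (Node v ts) = insert v (\<Union>t\<in>fset ts. verts t)"
  by (simp add: fimage.rep_eq)

text \<open>\<open>t\<close> has root \<open>s\<close> and vertex set \<open>S\<close>, and every vertex other than the root has exactly one
  parent; in particular \<open>parent\<close> is well defined there.\<close>

definition rooted_tree_on :: "'a rtree \<Rightarrow> 'a set \<Rightarrow> 'a \<Rightarrow> bool" where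
  "rooted_tree_on t S s \<longleftrightarrow> root t = s \<and> s \<in> S \<and> verts t = S \<and> edges t \<subseteq> S \<times> (S - {s}) \<and>
     (\<forall>i\<in>S - {s}. \<exists>!j. (j, i) \<in> edges t)"

lemma rooted_tree_on_Node:
  assumes ok: "\<And>x. x |\<in>| X \<Longrightarrow> rooted_tree_on (f x) (g x) (r x)"
    and disj: "\<And>x y. x |\<in>| X \<Longrightarrow> y |\<in>| X \<Longrightarrow> x \<noteq> y \<Longrightarrow> g x \<inter> g y = {}"
    and s: "\<And>x. x |\<in>| X \<Longrightarrow> s \<notin> g x"
    and S: "S = insert s (\<Union>x\<in>fset X. g x)"
  shows "rooted_tree_on (Node s (f |`| X)) S s"
proof -
  have e: "(j, i) \<in> edges (Node s (f |`| X)) \<longleftrightarrow>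
    (\<exists>x. x |\<in>| X \<and> (j = s \<and> i = r x \<or> (j, i) \<in> edges (f x)))" for j i
  proof -
    have "root (f x) = r x" if "x |\<in>| X" for x using ok[OF that] by (simp add: rooted_tree_on_def)
    then have "(\<exists>t. t |\<in>| f |`| X \<and> (j = s \<and> i = root t \<or> (j, i) \<in> edges t)) \<longleftrightarrow>
        (\<exists>x\<in>fset X. j = s \<and> i = r x \<or> (j, i) \<in> edges (f x))"
      by (auto simp: fimage.rep_eq)
    then show ?thesis unfolding edges_Node by blast
  qed
  have sub: "j \<in> g x \<and> i \<in> g x \<and> i \<noteq> r x" if "x |\<in>| X" "(j, i) \<in> edges (f x)" for x i j
    using ok[OF that(1)] that(2) by (auto simp: rooted_tree_on_def)
  have rg: "r x \<in> g x" if "x |\<in>| X" for x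
    using ok[OF that] by (auto simp: rooted_tree_on_def)
  have uniq: "\<exists>!j. (j, i) \<in> edges (Node s (f |`| X))" if i: "i \<in> S - {s}" for i
  proof -
    obtain x where x: "x |\<in>| X" "i \<in> g x" using i S by auto
    have same: "y = x" if "y |\<in>| X" "i \<in> g y" for y using disj x that by blast
    show ?thesis
    proof (cases "i = r x")
      case True
      show ?thesis unfolding e using True x same sub rg by (intro ex1I[of _ s]) blast+
    next
      case False
      then obtain j where j: "(j, i) \<in> edges (f x)" and u: "\<And>j'. (j', i) \<in> edges (f x) \<Longrightarrow> j' = j"
        using ok[OF x(1)] x(2) unfolding rooted_tree_on_def by blast
      show ?thesis
        unfolding e
      proof (rule ex1I[of _ j])
        show "\<exists>x. x |\<in>| X \<and> (j = s \<and> i = r x \<or> (j, i) \<in> edges (f x))" using j x(1) by blast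
      next
        fix j' assume "\<exists>x. x |\<in>| X \<and> (j' = s \<and> i = r x \<or> (j', i) \<in> edges (f x))"
        then obtain y where y: "y |\<in>| X" "j' = s \<and> i = r y \<or> (j', i) \<in> edges (f y)" by blast
        then have "i \<in> g y" using sub rg by blast
        then have "y = x" using same y(1) by blast
        then show "j' = j" using y(2) False u by blast
      qed
    qed
  qed
  have "edges (Node s (f |`| X)) \<subseteq> S \<times> (S - {s})"
  proof (rule subrelI)
    fix j i assume "(j, i) \<in> edges (Node s (f |`| X))"
    then obtain x where x: "x |\<in>| X" "j = s \<and> i = r x \<or> (j, i) \<in> edges (f x)" unfolding e by blast
    then have "i \<in> g x" "j = s \<or> j \<in> g x" using sub rg by blast+
    then show "(j, i) \<in> S \<times> (S - {s})" using x(1) s[OF x(1)] S by blast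
  qed
  moreover have "verts (Node s (f |`| X)) = S"
    unfolding verts_Node S using ok by (simp add: rooted_tree_on_def)
  ultimately show ?thesis using uniq S by (simp add: rooted_tree_on_def)
qed

lemma rooted_tree_on_cycle_tree: "marked_cycle S \<sigma> s \<Longrightarrow> rooted_tree_on (cycle_tree S \<sigma> s) S s"
proof (induction S \<sigma> s rule: cycle_tree.induct)
  case (1 S \<sigma> s)
  show ?case
  proof (cases "S = {s}")
    case True
    then show ?thesis by (subst cycle_tree.simps) (simp add: rooted_tree_on_def)
  next
    case False
    have sS: "s \<in> S" using 1(2) Min_in Max_in unfolding marked_cycle_def by blast
    let ?B = "cycle_blocks S \<sigma> s"
    have cc: "concat ?B = cycle_word S \<sigma> s" by (simp add: cycle_blocks_def concat_rl_blocks)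
    have p: "distinct (s # concat ?B)" "set (s # concat ?B) = S"
      using cycle_word_props[OF _ sS, of \<sigma>] 1(2) unfolding cc marked_cycle_def by blast+
    have ne: "[] \<notin> set ?B" unfolding cycle_blocks_def by (rule Nil_notin_rl_blocks)
    have "rooted_tree_on (Node s ((\<lambda>b. cycle_tree (set b) (cycle_of_list b) (last b)) |`| fset_of_list ?B)) S s"
    proof (rule rooted_tree_on_Node[where g = set and r = last])
      fix b assume "b |\<in>| fset_of_list ?B"
      then show "rooted_tree_on (cycle_tree (set b) (cycle_of_list b) (last b)) (set b) (last b)"
        using 1 False marked_cycle_cycle_blocks[OF 1(2)] by (simp add: fset_of_list_elem)
    next
      fix b b' assume "b |\<in>| fset_of_list ?B" "b' |\<in>| fset_of_list ?B" "b \<noteq> b'"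
      then show "set b \<inter> set b' = {}"
        using p(1) ne by (intro distinct_concat_disjoint[of ?B]) (auto simp: fset_of_list_elem)
    next
      fix b assume "b |\<in>| fset_of_list ?B"
      then show "s \<notin> set b" using p(1) by (auto simp: fset_of_list_elem)
    qed (use p(2) in \<open>auto simp: fset_of_list.rep_eq\<close>)
    then show ?thesis using False by (subst cycle_tree.simps) simp
  qed
qed

lemma rooted_tree_on_perm_tree:
  assumes "\<pi> permutes {1..n+1}"
  shows "rooted_tree_on (perm_tree n \<pi>) {0..n+1} 0"
proof -
  have fs: "fset (Abs_fset (perm_cycles n \<pi>)) = perm_cycles n \<pi>"
    by (rule Abs_fset_inverse) (simp add: perm_cycles_def)
  have cyc: "cyclic_on \<pi> C" if "C \<in> perm_cycles n \<pi>" for C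
    using that cyclic_on_orbit[OF assms] by (auto simp: perm_cycles_def)
  show ?thesis
    unfolding perm_tree_def
  proof (rule rooted_tree_on_Node[where g = id and r = Max])
    fix C assume "C |\<in>| Abs_fset (perm_cycles n \<pi>)"
    then have C: "C \<in> perm_cycles n \<pi>" using fs by auto
    show "rooted_tree_on (cycle_tree C (perm_restrict \<pi> C) (Max C)) (id C) (Max C)"
      using rooted_tree_on_cycle_tree[OF perm_cycles_props(1)[OF assms C]] by simp
    show "0 \<notin> id C" using perm_cycles_props(2)[OF assms C] by auto
  next
    fix C D assume CD: "C |\<in>| Abs_fset (perm_cycles n \<pi>)" "D |\<in>| Abs_fset (perm_cycles n \<pi>)" "C \<noteq> D"
    have "x \<in> C \<Longrightarrow> C = orbit \<pi> x" "x \<in> D \<Longrightarrow> D = orbit \<pi> x" for x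
      using cyc CD(1,2) fs by (simp_all add: cyclic_on_alldef)
    then show "id C \<inter> id D = {}" using CD(3) by (metis disjoint_iff id_apply)
  next
    have "\<Union> (perm_cycles n \<pi>) = {1..n+1}"
    proof
      show "\<Union> (perm_cycles n \<pi>) \<subseteq> {1..n+1}" using perm_cycles_props(2)[OF assms] by blast
      show "{1..n+1} \<subseteq> \<Union> (perm_cycles n \<pi>)"
        using permutation_self_in_orbit[of \<pi>] assms permutation_permutes
        by (auto simp: perm_cycles_def)
    qed
    then show "{0..n+1} = insert 0 (\<Union>C\<in>fset (Abs_fset (perm_cycles n \<pi>)). id C)"
      unfolding fs by auto
  qed
qed

text \<open>Elements of $\{0,1\}^n$ are functions in \<open>{1..n} \<rightarrow>\<^sub>E {0, 1}\<close>.\<close>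

definition char_vector :: "nat \<Rightarrow> nat set \<Rightarrow> nat \<Rightarrow> nat" where
  "char_vector n A = (\<lambda>i\<in>{1..n}. if i \<in> A then 1 else 0)"

definition tree_exc :: "nat \<Rightarrow> nat rtree \<Rightarrow> nat \<Rightarrow> nat" where
  "tree_exc n t = (\<lambda>i\<in>{1..n}. if i < parent t i then 1 else 0)"

definition tree_yy :: "nat \<Rightarrow> nat rtree \<Rightarrow> nat" where
  "tree_yy n t =
     card {(i, j). 1 \<le> i \<and> i < j \<and> j \<le> n \<and> parent t j < i \<and> j < parent t i}"

definition tree_c0 :: "nat rtree \<Rightarrow> nat" where
  "tree_c0 t = card (children t 0)"

definition tree_c1 :: "nat \<Rightarrow> nat rtree \<Rightarrow> nat" where
  "tree_c1 n t = card (children t (n+1))"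

definition perm_exc :: "nat \<Rightarrow> (nat \<Rightarrow> nat) \<Rightarrow> nat set" where
  "perm_exc n \<pi> = {i \<in> {1..n}. \<pi> i > i}"

definition perm_c :: "nat \<Rightarrow> (nat \<Rightarrow> nat) \<Rightarrow> nat" where
  "perm_c n \<pi> = card (perm_cycles n \<pi>)"

definition perm_c' :: "nat \<Rightarrow> (nat \<Rightarrow> nat) \<Rightarrow> nat" where
  "perm_c' n \<pi> = length (rl_extrema (>) (cycle_word (orbit \<pi> (n+1)) \<pi> (n+1)))"

definition perm_yy :: "nat \<Rightarrow> (nat \<Rightarrow> nat) \<Rightarrow> nat" where
  "perm_yy n \<pi> = tree_yy n (perm_tree n \<pi>)"

end

theory Submission
  imports Defs
begin

text \<open>Let \<open>i\<close> be a non-root vertex of \<open>T(\<sigma>, s)\<close>. If \<open>i\<close> is a child \<open>x\<^sub>j\<close> of the root, then both its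
  parent \<open>s\<close> and the letter \<open>\<sigma> i\<close> lie below \<open>i\<close> (when \<open>s\<close> is the minimum) or above it (when \<open>s\<close> is
  the maximum), because \<open>\<sigma> i\<close> is either \<open>s\<close> or the letter that follows the extremum \<open>i\<close> in \<open>W\<close>.
  Otherwise \<open>\<sigma>\<close> agrees at \<open>i\<close> with the permutation of the block containing \<open>i\<close>, and the claim is
  inherited from the subtree. Hence excedances of the tree are excedances of the permutation. The
  children of \<open>0\<close> and of \<open>n + 1\<close> can be read off from the construction.\<close>

section \<open>Blocks of a word and consecutive letters of a cycle\<close>

text \<open>A block ends at an extremum of the word, and the later blocks make up exactly what
  follows it. This compares a child of the root with the next letter.\<close>

lemma rl_blocks_after_last:
  assumes "rl_blocks R w = us @ b # vs" "x \<in> set (concat vs)"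
  shows "R x (last b)"
  using assms
proof (induction w arbitrary: us b)
  case (Cons a w)
  show ?case
  proof (cases "\<forall>b\<in>set w. R b a")
    case True
    then have eq: "[a] # rl_blocks R w = us @ b # vs"
      using Cons.prems by simp
    show ?thesis
    proof (cases us)
      case Nil
      then have "b = [a]" "set (concat vs) = set w"
        using eq concat_rl_blocks[of R w] by auto
      then show ?thesis
        using True Cons.prems(2) by auto
    next
      case (Cons u us')
      then show ?thesis
        using eq Cons.IH Cons.prems(2) by auto
    qed
  next
    case False
    then obtain c cs where c: "rl_blocks R w = c # cs"
      using concat_rl_blocks[of R w] by (cases "rl_blocks R w") auto
    have "c \<noteq> []"
      using c Nil_notin_rl_blocks[of R w] by auto
    have eq: "(a # c) # cs = us @ b # vs"
      using Cons.prems False c by auto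
    show ?thesis
    proof (cases us)
      case Nil
      then show ?thesis
        using eq c \<open>c \<noteq> []\<close> Cons.IH[of "[]" c] Cons.prems(2) by auto
    next
      case (Cons u us')
      then show ?thesis
        using eq c Cons.IH[of "c # us'" b] Cons.prems(2) by auto
    qed
  qed
qed simp

lemma cycle_of_list_next:
  assumes "distinct (p @ x # y # q)"
  shows "cycle_of_list (p @ x # y # q) x = y"
proof -
  let ?b = "p @ x # y # q"
  have "map (cycle_of_list ?b) ?b = rotate1 ?b"
    using cyclic_rotation[OF assms, of 1] by simp
  then have "map (cycle_of_list ?b) ?b ! length p = rotate1 ?b ! length p"
    by simp
  then show ?thesis
    by (simp add: nth_rotate1 nth_append)
qed

lemma cycle_word_next:
  assumes "cycle_word S \<sigma> s = u @ x # y # v"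
  shows "\<sigma> x = y"
proof -
  have len: "card S - 1 = length u + length v + 2"
    using arg_cong[OF assms, of length] by (simp add: cycle_word_def)
  have nth: "cycle_word S \<sigma> s ! k = (\<sigma> ^^ Suc k) s" if "k < card S - 1" for k
    using that by (simp add: cycle_word_def)
  have "x = (\<sigma> ^^ Suc (length u)) s"
    using nth[of "length u"] len unfolding assms by (simp add: nth_append)
  moreover have "y = (\<sigma> ^^ Suc (Suc (length u))) s"
    using nth[of "Suc (length u)"] len unfolding assms by (simp add: nth_append)
  ultimately show ?thesis
    by simp
qed

text \<open>Some letter is sent to \<open>s\<close>. It is not \<open>s\<close>, which goes to the
  first letter of the word, and not an earlier letter of the word, which goes to its successor
  there. Only \<open>x\<close> remains.\<close>

lemma cycle_word_last:
  assumes "\<sigma> permutes S" "cyclic_on \<sigma> S" "s \<in> S" "cycle_word S \<sigma> s = u @ [x]"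
  shows "\<sigma> x = s"
proof -
  have dist: "distinct (s # u @ [x])" and set: "set (s # u @ [x]) = S"
    using cycle_word_props[OF assms(2,3)] unfolding assms(4) by auto
  obtain z where z: "z \<in> S" "\<sigma> z = s"
    using assms(1,3) by (metis image_iff permutes_image)
  have "cycle_word S \<sigma> s ! 0 = \<sigma> s"
    using arg_cong[OF assms(4), of length] by (simp add: cycle_word_def)
  then have "\<sigma> s \<in> set (u @ [x])"
    unfolding assms(4) by (metis length_append_singleton nth_mem zero_less_Suc)
  then have "z \<noteq> s"
    using dist z by auto
  moreover have "z \<notin> set u"
  proof
    assume "z \<in> set u"
    then obtain p q where "u = p @ z # q"
      by (meson split_list)
    \<comment> \<open>As \<open>q\<close> may be empty, the letter after \<open>z\<close> is written
      as the head of \<open>q @ [x]\<close>.\<close>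
    then have w: "cycle_word S \<sigma> s = p @ z # hd (q @ [x]) # tl (q @ [x])"
      using assms(4) by simp
    then have "hd (q @ [x]) = s"
      using cycle_word_next z(2) by metis
    then have "s \<in> set (q @ [x])"
      by (metis append_is_Nil_conv list.set_sel(1) not_Cons_self2)
    then show False
      using dist \<open>u = p @ z # q\<close> by auto
  qed
  ultimately show ?thesis
    using z set by auto
qed

section \<open>Excedances along the edges of a cycle tree\<close>

lemma cycle_tree_unfold:
  "cycle_tree S \<sigma> s = Node s ((\<lambda>b. cycle_tree (set b) (cycle_of_list b) (last b))
     |`| fset_of_list (cycle_blocks S \<sigma> s))"
  \<comment> \<open>If \<open>S = {s}\<close>, the word is empty and there are no blocks, so the
    general equation covers the single vertex too.\<close>
  by (subst cycle_tree.simps) (auto simp: cycle_blocks_def cycle_word_def)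

lemma root_cycle_tree: "root (cycle_tree S \<sigma> s) = s"
  by (subst cycle_tree_unfold) simp

lemma edges_cycle_tree:
  "(j, i) \<in> edges (cycle_tree S \<sigma> s) \<longleftrightarrow>
     (\<exists>b\<in>set (cycle_blocks S \<sigma> s). j = s \<and> i = last b \<or>
        (j, i) \<in> edges (cycle_tree (set b) (cycle_of_list b) (last b)))"
  by (subst cycle_tree_unfold, unfold edges_Node)
    (auto simp: root_cycle_tree fset_of_list_elem fimage.rep_eq fset_of_list.rep_eq)

text \<open>Both markings have to be treated together, since the blocks of a cycle marked at its
  minimum are marked at their maxima and vice versa.\<close>

lemma cycle_tree_exc:
  assumes "marked_cycle S \<sigma> s" "(j, i) \<in> edges (cycle_tree S \<sigma> s)"
  shows "i < j \<longleftrightarrow> i < \<sigma> i"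
  using assms
proof (induction "card S" arbitrary: S \<sigma> s rule: less_induct)
  case less
  let ?w = "cycle_word S \<sigma> s"
  \<comment> \<open>One relation serves both markings: \<open>?R s i\<close> and
    \<open>?R (\<sigma> i) i\<close> put \<open>s\<close> and \<open>\<sigma> i\<close> on the same
    side of \<open>i\<close>, so the two inequalities in the claim agree.\<close>
  let ?R = "if s = Min S then (<) else (>)"
  have \<sigma>: "\<sigma> permutes S" "cyclic_on \<sigma> S" "s \<in> {Min S, Max S}" "finite S" "S \<noteq> {}"
    using less.prems(1) by (auto simp: marked_cycle_def)
  then have s: "s \<in> S"
    using Min_in Max_in by blast
  have w: "distinct (s # ?w)" "set (s # ?w) = S"
    using cycle_word_props[OF \<sigma>(2) s] .
  have R_s: "?R s x" if "x \<in> set ?w" for x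
  proof -
    have "x \<in> S" "x \<noteq> s"
      using that w by auto
    then have "Min S \<le> x" "x \<le> Max S"
      using \<sigma>(4) by auto
    then show ?thesis
      using \<sigma>(3) \<open>x \<noteq> s\<close> by auto
  qed
  obtain b where b: "b \<in> set (cycle_blocks S \<sigma> s)"
    and edge: "j = s \<and> i = last b \<or> (j, i) \<in> edges (cycle_tree (set b) (cycle_of_list b) (last b))"
    using less.prems(2) edges_cycle_tree by metis
  obtain us vs where split: "rl_blocks ?R ?w = us @ b # vs"
    using b unfolding cycle_blocks_def by (meson split_list)
  have w_split: "?w = concat us @ b @ concat vs"
    using concat_rl_blocks[of ?R ?w] unfolding split by simp
  have "b \<noteq> []"
    using b Nil_notin_rl_blocks unfolding cycle_blocks_def by blast
  show ?case
    using edge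
  proof
    assume ji: "j = s \<and> i = last b"
    have "?R s i"
      using R_s[of i] ji \<open>b \<noteq> []\<close> w_split by auto
    moreover have "?R (\<sigma> i) i"
    proof (cases "concat vs")
      case Nil
      then have "?w = (concat us @ butlast b) @ [i]"
        using w_split ji \<open>b \<noteq> []\<close> by simp
      then show ?thesis
        using cycle_word_last[OF \<sigma>(1,2) s] \<open>?R s i\<close> by metis
    next
      case (Cons y v)
      then have "?w = (concat us @ butlast b) @ i # y # v"
        using w_split ji \<open>b \<noteq> []\<close> by simp
      then have "\<sigma> i = y"
        by (rule cycle_word_next)
      then show ?thesis
        using rl_blocks_after_last[OF split, of y] Cons ji by simp
    qed
    ultimately show ?thesis
      using ji by (auto split: if_splits)
  next
    assume e: "(j, i) \<in> edges (cycle_tree (set b) (cycle_of_list b) (last b))"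
    have mb: "marked_cycle (set b) (cycle_of_list b) (last b)"
      using marked_cycle_cycle_blocks[OF less.prems(1) b] .
    then have i: "i \<in> set b" "i \<noteq> last b"
      using e rooted_tree_on_cycle_tree[OF mb] unfolding rooted_tree_on_def by auto
    then obtain p q where pq: "b = p @ i # q"
      by (meson split_list)
    \<comment> \<open>Since \<open>i\<close> does not end its block, its successor \<open>y\<close>
      in the whole word still lies in the block, and both permutations send \<open>i\<close> to
      \<open>y\<close>.\<close>
    then obtain y q' where q: "q = y # q'"
      using i(2) by (cases q) auto
    have "\<sigma> i = y"
      by (rule cycle_word_next[of S \<sigma> s "concat us @ p" _ _ "q' @ concat vs"])
        (simp add: w_split pq q)
    moreover have "cycle_of_list b i = y"
      unfolding pq q by (rule cycle_of_list_next) (use w(1) w_split pq q in auto)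
    moreover have "set b \<subset> S"
      using w w_split by auto
    then have "card (set b) < card S"
      using \<sigma>(4) by (rule psubset_card_mono[rotated])
    then have "i < j \<longleftrightarrow> i < cycle_of_list b i"
      using less.hyps mb e by blast
    ultimately show ?thesis
      by simp
  qed
qed

section \<open>Edges and children in the tree of a permutation\<close>

lemma edges_perm_tree:
  "(j, i) \<in> edges (perm_tree n \<pi>) \<longleftrightarrow>
     (\<exists>C\<in>perm_cycles n \<pi>. j = 0 \<and> i = Max C \<or>
        (j, i) \<in> edges (cycle_tree C (perm_restrict \<pi> C) (Max C)))"
proof -
  have "fset (Abs_fset (perm_cycles n \<pi>)) = perm_cycles n \<pi>"
    by (rule Abs_fset_inverse) (simp add: perm_cycles_def)
  then show ?thesis
    unfolding perm_tree_def edges_Node by (auto simp: root_cycle_tree fimage.rep_eq)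
qed

lemma edges_cycle_tree_subset:
  assumes "marked_cycle S \<sigma> s" "(j, i) \<in> edges (cycle_tree S \<sigma> s)"
  shows "j \<in> S" "i \<in> S" "i \<noteq> s"
  using rooted_tree_on_cycle_tree[OF assms(1)] assms(2) by (auto simp: rooted_tree_on_def)

text \<open>The letter \<open>s\<close> occurs in no block, so no subtree adds an edge leaving
  \<open>s\<close>.\<close>

lemma children_root_cycle_tree:
  assumes "marked_cycle S \<sigma> s"
  shows "children (cycle_tree S \<sigma> s) s = last ` set (cycle_blocks S \<sigma> s)"
proof -
  have s: "s \<in> S" and c: "cyclic_on \<sigma> S"
    using assms Min_in Max_in unfolding marked_cycle_def by blast+
  have "s \<notin> set b" if "b \<in> set (cycle_blocks S \<sigma> s)" for b
    using cycle_word_props(1)[OF c s] that set_rl_blocks_subset unfolding cycle_blocks_def by force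
  then have "(s, i) \<notin> edges (cycle_tree (set b) (cycle_of_list b) (last b))"
    if "b \<in> set (cycle_blocks S \<sigma> s)" for b i
    using edges_cycle_tree_subset(1)[OF marked_cycle_cycle_blocks[OF assms that]] that by blast
  then have "(s, i) \<in> edges (cycle_tree S \<sigma> s) \<longleftrightarrow> i \<in> last ` set (cycle_blocks S \<sigma> s)" for i
    using edges_cycle_tree[of s i S \<sigma> s] by blast
  then show ?thesis
    by (auto simp: children_def)
qed

lemma set_rl_extrema_subset: "set (rl_extrema R w) \<subseteq> set w"
  by (induction w) auto

text \<open>Allows the length that defines \<open>perm_c'\<close> to be compared with the
  cardinality that defines \<open>tree_c1\<close>.\<close>

lemma distinct_rl_extrema: "distinct w \<Longrightarrow> distinct (rl_extrema R w)"
  by (induction w) (use set_rl_extrema_subset in force)+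

lemma perm_cycles_eq_orbit:
  assumes "\<pi> permutes {1..n+1}" "C \<in> perm_cycles n \<pi>" "x \<in> C"
  shows "C = orbit \<pi> x"
  using assms cyclic_on_orbit[OF assms(1)] by (auto simp: perm_cycles_def cyclic_on_alldef)

lemma cycle_word_perm_restrict:
  assumes "cyclic_on \<pi> C" "s \<in> C"
  shows "cycle_word C (perm_restrict \<pi> C) s = cycle_word C \<pi> s"
proof -
  have "(perm_restrict \<pi> C ^^ k) s = (\<pi> ^^ k) s" for k
    using cyclic_on_funpow_in[OF assms]
    by (induction k) (simp_all add: perm_restrict_simps)
  then show ?thesis
    by (simp add: cycle_word_def)
qed

section \<open>The statistics, one by one\<close>

lemma tree_exc_perm_tree:
  assumes "\<pi> permutes {1..n+1}"
  shows "tree_exc n (perm_tree n \<pi>) = char_vector n (perm_exc n \<pi>)"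
proof -
  let ?T = "perm_tree n \<pi>"
  have "i < parent ?T i \<longleftrightarrow> i < \<pi> i" if i: "i \<in> {1..n}" for i
  proof -
    have "\<exists>!j. (j, i) \<in> edges ?T"
      using rooted_tree_on_perm_tree[OF assms] i unfolding rooted_tree_on_def by auto
    then have "(parent ?T i, i) \<in> edges ?T"
      unfolding parent_def by (rule theI')
    then obtain C where C: "C \<in> perm_cycles n \<pi>" and edge: "parent ?T i = 0 \<and> i = Max C \<or>
        (parent ?T i, i) \<in> edges (cycle_tree C (perm_restrict \<pi> C) (Max C))"
      unfolding edges_perm_tree by blast
    note mc = perm_cycles_props(1)[OF assms C]
    then have "finite C" "C \<noteq> {}"
      by (auto simp: marked_cycle_def)
    show ?thesis
      using edge
    proof
      \<comment> \<open>The maximum of a cycle is an excedance on neither side: its parent is 0, and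
        \<open>\<pi>\<close> cannot raise it.\<close>
      assume e: "parent ?T i = 0 \<and> i = Max C"
      then have "i \<in> C"
        using \<open>finite C\<close> \<open>C \<noteq> {}\<close> by simp
      then have "\<pi> i \<in> C"
        using perm_cycles_eq_orbit[OF assms C] by (metis orbit.base)
      then have "\<pi> i \<le> i"
        using e \<open>finite C\<close> by simp
      then show ?thesis
        using e by auto
    next
      assume e: "(parent ?T i, i) \<in> edges (cycle_tree C (perm_restrict \<pi> C) (Max C))"
      then show ?thesis
        using cycle_tree_exc[OF mc e] edges_cycle_tree_subset(2)[OF mc e]
        by (simp add: perm_restrict_simps)
    qed
  qed
  then show ?thesis
    by (auto simp: tree_exc_def char_vector_def perm_exc_def fun_eq_iff restrict_def)
qed

text \<open>The vertex 0 lies in no cycle, so its children are the cycle maxima; these are distinct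
  because a cycle is the orbit of any of its elements.\<close>

lemma tree_c0_perm_tree:
  assumes "\<pi> permutes {1..n+1}"
  shows "tree_c0 (perm_tree n \<pi>) = perm_c n \<pi>"
proof -
  have "(0, i) \<notin> edges (cycle_tree C (perm_restrict \<pi> C) (Max C))" if "C \<in> perm_cycles n \<pi>" for C i
    using edges_cycle_tree_subset(1)[OF perm_cycles_props(1)[OF assms that]]
      perm_cycles_props(2)[OF assms that] by fastforce
  then have "children (perm_tree n \<pi>) 0 = Max ` perm_cycles n \<pi>"
    by (auto simp: children_def edges_perm_tree)
  moreover have "inj_on Max (perm_cycles n \<pi>)"
  proof (rule inj_onI)
    fix C D assume CD: "C \<in> perm_cycles n \<pi>" "D \<in> perm_cycles n \<pi>" "Max C = Max D"
    have Max_in_cycle: "Max E \<in> E" if "E \<in> perm_cycles n \<pi>" for E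
      using perm_cycles_props(1)[OF assms that] by (simp add: marked_cycle_def)
    show "C = D"
      using perm_cycles_eq_orbit[OF assms] Max_in_cycle CD by metis
  qed
  ultimately show ?thesis
    by (simp add: tree_c0_def perm_c_def card_image)
qed

text \<open>As the maximum of its cycle, \<open>n+1\<close> is the root of a cycle tree, so its
  children are the last letters of the blocks, which are the right-to-left minima.\<close>

lemma tree_c1_perm_tree:
  assumes "\<pi> permutes {1..n+1}"
  shows "tree_c1 n (perm_tree n \<pi>) = perm_c' n \<pi>"
proof -
  let ?C = "orbit \<pi> (n+1)"
  let ?w = "cycle_word ?C \<pi> (n+1)"
  let ?t = "cycle_tree ?C (perm_restrict \<pi> ?C) (n+1)"
  have C: "?C \<in> perm_cycles n \<pi>"
    by (simp add: perm_cycles_def)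
  have cyc: "cyclic_on \<pi> ?C"
    using cyclic_on_orbit[OF assms] by simp
  have mem: "n+1 \<in> ?C"
    using permutation_self_in_orbit[of \<pi>] assms permutation_permutes by blast
  have max: "Max ?C = n+1"
    using perm_cycles_props[OF assms C] mem
    by (intro Max_eqI) (auto simp: marked_cycle_def)
  have mc: "marked_cycle ?C (perm_restrict \<pi> ?C) (n+1)"
    using perm_cycles_props(1)[OF assms C] unfolding max .
  have edge: "(n+1, i) \<in> edges (perm_tree n \<pi>) \<longleftrightarrow> (n+1, i) \<in> edges ?t" for i
  proof -
    have "D = ?C" if "D \<in> perm_cycles n \<pi>"
      "(n+1, i) \<in> edges (cycle_tree D (perm_restrict \<pi> D) (Max D))" for D
      using edges_cycle_tree_subset(1)[OF perm_cycles_props(1)[OF assms that(1)] that(2)]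
        perm_cycles_eq_orbit[OF assms that(1)] by blast
    then show ?thesis
      using C max unfolding edges_perm_tree by (metis add_is_0 one_neq_zero)
  qed
  have blocks: "cycle_blocks ?C (perm_restrict \<pi> ?C) (n+1) = rl_blocks (>) ?w"
  \<comment> \<open>If \<open>n+1\<close> is a fixed point, it is also the minimum of its cycle and
    \<open>cycle_blocks\<close> selects \<open>(<)\<close>; the word is then empty and both orders
    give no blocks.\<close>
  proof (cases "n+1 = Min ?C")
    case True
    have "finite ?C"
      using mc by (simp add: marked_cycle_def)
    then have "x = n+1" if "x \<in> ?C" for x
      using Min_le[of ?C x] Max_ge[of ?C x] that max True by linarith
    then have "?C = {n+1}"
      using mem by blast
    then have "card ?C = 1"
      by simp
    then show ?thesis
      by (simp add: cycle_blocks_def cycle_word_def)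
  next
    case False
    then show ?thesis
      unfolding cycle_blocks_def cycle_word_perm_restrict[OF cyc mem] by simp
  qed
  have "children (perm_tree n \<pi>) (n+1) = children ?t (n+1)"
    using edge by (simp add: children_def)
  also have "\<dots> = set (map last (rl_blocks (>) ?w))"
    unfolding children_root_cycle_tree[OF mc] blocks by simp
  also have "\<dots> = set (rl_extrema (>) ?w)"
    unfolding map_last_rl_blocks ..
  finally show ?thesis
    using distinct_rl_extrema[of ?w] cycle_word_props(1)[OF cyc mem]
    by (simp add: tree_c1_def perm_c'_def distinct_card)
qed

theorem theorem3p2:
  fixes n :: nat and \<pi> :: "nat \<Rightarrow> nat" and \<T> :: "nat rtree"
  assumes "\<pi> permutes {1..n+1}"
    and "\<T> = perm_tree n \<pi>"
  shows "(tree_exc n \<T>, tree_c0 \<T>, tree_c1 n \<T>, tree_yy n \<T>)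
       = (char_vector n (perm_exc n \<pi>), perm_c n \<pi>, perm_c' n \<pi>, perm_yy n \<pi>)"
  \<comment> \<open>The fourth components agree by the definition of \<open>perm_yy\<close>.\<close>
  using tree_exc_perm_tree[OF assms(1)] tree_c0_perm_tree[OF assms(1)] tree_c1_perm_tree[OF assms(1)]
  by (simp add: assms(2) perm_yy_def)

end
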